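(* Let $n\ge1$. For any $\epsilon>0$ there exists $\delta>0$ such that for Lebesgue almost every $v\in\mathbb{R}^n$, $$\dim_H \mathbf{Bad}^\epsilon(v)<n-\delta.$$
   Context: For $t\in\mathbb{R}^n$, $\langle t\rangle$ denotes the (Euclidean) distance from $t$ to $\mathbb{Z}^n$. For $v\in\mathbb{R}^n$ and $\epsilon>0$, $\mathbf{Bad}^\epsilon(v)=\{w\in\mathbb{R}^n:\liminf_{k\to\infty}k^{1/n}\langle kv-w\rangle\ge\epsilon\}$, where $k$ ranges over positive integers. $\dim_H$ is Hausdorff dimension with respect to the Euclidean metric. *)

theory Defs
  imports "HOL-Analysis.Analysis"
begin

text \<open>The summand \<open>diam(U)^s\<close>, with the usual conventions \<open>diam({})^s = 0\<close> and
  \<open>diam(U)^0 = 1\<close> for nonempty \<open>U\<close>; the latter has to be stated separately because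
  \<open>0 powr 0 = 0\<close>.\<close>

definition diam_powr :: "real \<Rightarrow> 'a::metric_space set \<Rightarrow> real" where
  "diam_powr s U = (if U = {} then 0 else if s = 0 then 1 else diameter U powr s)"

text \<open>Covers consist of bounded sets, since the real-valued \<^const>\<open>diameter\<close> is
  meaningless for unbounded ones.\<close>

definition hausdorff_premeasure :: "real \<Rightarrow> real \<Rightarrow> 'a::metric_space set \<Rightarrow> ennreal" where
  "hausdorff_premeasure s r A =
     (INF U \<in> {U :: nat \<Rightarrow> 'a set. A \<subseteq> (\<Union>i. U i) \<and> (\<forall>i. bounded (U i) \<and> diameter (U i) \<le> r)}.
        \<Sum>i. ennreal (diam_powr s (U i)))"

definition hausdorff_measure :: "real \<Rightarrow> 'a::metric_space set \<Rightarrow> ennreal" where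
  "hausdorff_measure s A = (SUP r \<in> {0<..}. hausdorff_premeasure s r A)"

definition hausdorff_dim :: "'a::metric_space set \<Rightarrow> ereal" where
  "hausdorff_dim A = (INF s \<in> {s :: real. 0 \<le> s \<and> hausdorff_measure s A = 0}. ereal s)"

definition int_lattice :: "(real ^ 'n) set" where
  "int_lattice = {z. \<forall>i. z $ i \<in> \<int>}"

definition dist_int :: "real ^ 'n \<Rightarrow> real" where
  "dist_int t = infdist t int_lattice"

text \<open>The lower limit is taken in the extended reals, as it may be infinite. The term
  \<open>k = 0\<close> has no effect on it.\<close>

definition Bad :: "real \<Rightarrow> real ^ 'n \<Rightarrow> (real ^ 'n) set" where
  "Bad \<epsilon> v =
     {w. liminf (\<lambda>k::nat. ereal (real k powr (1 / real CARD('n)) * dist_int (real k *\<^sub>R v - w)))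
           \<ge> ereal \<epsilon>}"

end

theory Submission
  imports Defs
begin

text \<open>
  Write \<open>n\<close> for the dimension and \<open>\<langle>t\<rangle>\<close> for the distance to the integer lattice. Call \<open>v\<close>
  resonant at \<open>N\<close> if \<open>\<langle>q v\<rangle> < 1 / (64 N\<^sup>1\<^sup>/\<^sup>n)\<close> for some \<open>1 \<le> q \<le> N\<close>. The proof rests on two facts
  about this notion.

  First, at a nonresonant \<open>N\<close> the orbit of \<open>v\<close> on the torus is well distributed: every point of
  the torus lies within a constant times \<open>N\<^sup>-\<^sup>1\<^sup>/\<^sup>n\<close> of some \<open>k v\<close> with \<open>k\<close> between \<open>N\<close> and a constant
  times \<open>N\<close> (\<open>orbit_dense_if_separated\<close>). Around each such \<open>k v\<close> no \<open>w\<close> satisfies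
  \<open>k\<^sup>1\<^sup>/\<^sup>n \<langle>k v - w\<rangle> > \<epsilon> / 2\<close> inside a ball of radius comparable to \<open>\<epsilon> N\<^sup>-\<^sup>1\<^sup>/\<^sup>n\<close>. Hence the set of \<open>w\<close>
  for which this inequality holds for all \<open>k \<ge> K\<close>, with a fixed \<open>K \<le> N\<close>, has a hole of relative size
  at least \<open>1 / \<beta>\<close> in each cube of the corresponding side length, where \<open>\<beta>\<close> depends on \<open>n\<close> and \<open>\<epsilon>\<close> only
  (\<open>hole_in_cube_if_not_resonant\<close>). Passing from the grid of side \<open>\<beta>\<^sup>-\<^sup>j\<close> to the grid of
  side \<open>\<beta>\<^sup>-\<^sup>j\<^sup>-\<^sup>1\<close>, the number of occupied cubes therefore grows by the factor \<open>\<beta>\<^sup>n - 1\<close> at most,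
  instead of \<open>\<beta>\<^sup>n\<close>, whenever the scale \<open>j\<close> is nonresonant. If for infinitely many \<open>J\<close> a third of
  the scales \<open>j < J\<close> are of this kind, then covering by the cubes of side \<open>\<beta>\<^sup>-\<^sup>J\<close> for these \<open>J\<close>
  shows that the dimension is smaller than \<open>n\<close> by a definite amount
  (\<open>hausdorff_measure_0_if_porous\<close>). Infinitely many \<open>J\<close> are enough, because each Hausdorff
  premeasure is an infimum over covers.

  Second, resonance is rare: summing over \<open>q\<close> the measure of the neighbourhoods of the rational
  points with denominator \<open>q\<close> shows that in any fixed box the vectors resonant at scale \<open>j\<close>
  eventually fill an eighth of the volume at most (\<open>eventually_measure_resonant_le\<close>). Averaging
  over \<open>j < J\<close>, for each \<open>m\<close> those \<open>v\<close> for which more than half of the scales below \<open>J\<close> are resonant for all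
  \<open>J \<ge> m\<close> fill half of each box at most. A measurable set with this property is null
  (\<open>negligible_if_half_in_boxes\<close>), so almost every \<open>v\<close> has the required supply of nonresonant
  scales. The same constants serve every such \<open>v\<close>, which makes \<open>\<delta>\<close> uniform.
\<close>

section \<open>Distance to the integer lattice\<close>

lemma int_lattice_uminus: "z \<in> int_lattice \<Longrightarrow> - z \<in> int_lattice"
  and zero_in_int_lattice: "0 \<in> int_lattice"
  by (auto simp: int_lattice_def)

lemma dist_int_le_dist: "z \<in> int_lattice \<Longrightarrow> dist_int t \<le> dist t z"
  unfolding dist_int_def by (rule infdist_le)

lemma dist_int_le_norm: "dist_int t \<le> norm t"
  using dist_int_le_dist[OF zero_in_int_lattice] by simp

lemma dist_int_less_obtain:
  assumes "dist_int t < r"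
  obtains z where "z \<in> int_lattice" "dist t z < r"
  using assms zero_in_int_lattice cINF_less_iff[of int_lattice "dist t" r]
  unfolding dist_int_def infdist_def by (auto split: if_splits)

lemma dist_int_minus: "dist_int (- t) = dist_int t"
proof -
  have "dist_int (- t) \<le> dist_int t" for t :: "real ^ 'n"
  proof (rule ccontr)
    assume "\<not> dist_int (- t) \<le> dist_int t"
    then obtain z where "z \<in> int_lattice" "dist t z < dist_int (- t)"
      by (meson dist_int_less_obtain not_le)
    then show False
      using dist_int_le_dist[OF int_lattice_uminus, of z "- t"]
      by (simp add: dist_norm norm_minus_commute)
  qed
  from this[of t] this[of "- t"] show ?thesis by simp
qed

lemma dist_int_triangle: "dist_int (s + t) \<le> dist_int s + dist_int t"
proof (rule ccontr)
  assume "\<not> ?thesis"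
  then obtain e where e: "dist_int s < dist_int s + e" "dist_int t < dist_int t + e"
      "dist_int s + e + (dist_int t + e) \<le> dist_int (s + t)"
    by (intro that[of "(dist_int (s + t) - dist_int s - dist_int t) / 2"]) auto
  obtain y z where "y \<in> int_lattice" "dist s y < dist_int s + e"
      "z \<in> int_lattice" "dist t z < dist_int t + e"
    using e dist_int_less_obtain by metis
  moreover have "y + z \<in> int_lattice"
    using calculation by (auto simp: int_lattice_def)
  ultimately show False
    using e(3) dist_int_le_dist[of "y + z" "s + t"] dist_triangle_add[of s t y z] by linarith
qed

lemma continuous_dist_int: "continuous_on UNIV dist_int"
  unfolding dist_int_def by (intro continuous_intros)

lemma norm_le_card_times_bound:
  fixes x :: "real ^ 'n"
  assumes "\<And>i. \<bar>x $ i\<bar> \<le> c"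
  shows "norm x \<le> real CARD('n) * c"
  using norm_le_l1_cart[of x] sum_bounded_above[of UNIV "\<lambda>i. \<bar>x $ i\<bar>" c] assms by force

section \<open>Well distributed orbits on the torus\<close>

text \<open>
  The pigeonhole principle for the torus cut into \<open>m\<^sup>n\<close> equal cells, whose diameter is below \<open>r\<close>.
\<close>

lemma card_separated_mod_int_le:
  fixes f :: "'k \<Rightarrow> real ^ 'n"
  assumes fin: "finite K"
    and sep: "\<And>x y. \<lbrakk>x \<in> K; y \<in> K; x \<noteq> y\<rbrakk> \<Longrightarrow> r \<le> dist_int (f x - f y)"
    and m: "m > 0" "real CARD('n) / real m \<le> r"
  shows "card K \<le> m ^ CARD('n)"
proof -
  define cell where "cell x = (\<lambda>i. nat \<lfloor>real m * frac (f x $ i)\<rfloor>)" for x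
  have "inj_on cell K"
  proof (rule inj_onI, rule ccontr)
    fix x y assume xy: "x \<in> K" "y \<in> K" "cell x = cell y" "x \<noteq> y"
    define z :: "real ^ 'n" where "z = (\<chi> i. of_int \<lfloor>f x $ i\<rfloor> - of_int \<lfloor>f y $ i\<rfloor>)"
    have comp: "\<bar>(f x - f y - z) $ i\<bar> < 1 / real m" for i
    proof -
      have "0 \<le> real m * frac (f x $ i)" "0 \<le> real m * frac (f y $ i)" by (auto simp: frac_ge_0)
      moreover have "nat \<lfloor>real m * frac (f x $ i)\<rfloor> = nat \<lfloor>real m * frac (f y $ i)\<rfloor>"
        using xy(3) by (simp add: cell_def fun_eq_iff)
      ultimately have "\<bar>real m * frac (f x $ i) - real m * frac (f y $ i)\<bar> < 1"
        by linarith
      then have "real m * \<bar>frac (f x $ i) - frac (f y $ i)\<bar> < 1"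
        by (simp add: abs_mult flip: right_diff_distrib)
      then show ?thesis using m(1) by (simp add: z_def frac_def field_simps)
    qed
    have "dist_int (f x - f y) \<le> norm (f x - f y - z)"
      using dist_int_le_dist[of z "f x - f y"] by (simp add: dist_norm z_def int_lattice_def)
    also have "\<dots> \<le> (\<Sum>i\<in>UNIV. \<bar>(f x - f y - z) $ i\<bar>)" by (rule norm_le_l1_cart)
    also have "\<dots> < (\<Sum>i\<in>(UNIV :: 'n set). 1 / real m)"
      by (intro sum_strict_mono comp) auto
    also have "\<dots> \<le> r" using m by simp
    finally show False using sep[OF xy(1,2,4)] by simp
  qed
  moreover have "cell ` K \<subseteq> (\<Pi>\<^sub>E i\<in>UNIV. {..<m})"
  proof -
    have "nat \<lfloor>real m * frac t\<rfloor> < m" for t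
    proof -
      have "real m * frac t < real m * 1" using m(1) frac_lt_1 by (intro mult_strict_left_mono) auto
      moreover have "0 \<le> real m * frac t" by (simp add: frac_ge_0)
      ultimately show ?thesis by (simp add: floor_less_iff nat_less_iff)
    qed
    then show ?thesis by (auto simp: cell_def)
  qed
  ultimately have "card K \<le> card (\<Pi>\<^sub>E i\<in>(UNIV :: 'n set). {..<m})"
    by (intro card_inj_on_le[of cell]) (auto intro!: finite_PiE)
  then show ?thesis by (simp add: card_PiE)
qed

text \<open>
  A lattice without short vectors has bounded covering radius, here for the lattice generated by
  the integer points and \<open>(v, 1)\<close>. Let \<open>A i\<close> consist of the points that can be reached from the
  lattice in \<open>i\<close> moves, where a move is a translation by \<open>l v\<close> with \<open>\<bar>l\<bar> \<le> M\<close> followed by one of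
  length at most \<open>r\<close>. If some \<open>w\<close> were outside \<open>A (3 L)\<close>, a path of short steps from \<open>0\<close> to \<open>w\<close> would
  cross every shell \<open>A (i + 1) - A i\<close>. Points in shells at least three levels apart, each
  translated by \<open>v, 2 v, \<dots>, M v\<close>, stay \<open>r\<close>-separated on the torus, since otherwise two moves,
  one by \<open>(k - k') v\<close> and one by at most \<open>r\<close>, would join the shells.
  Counting the shells \<open>0, 3, 6, \<dots>\<close> gives \<open>L M\<close> separated points, too many for the torus.
\<close>

lemma orbit_dense_if_separated:
  fixes v w :: "real ^ 'n"
  assumes r: "r > 0"
    and sep: "\<And>q. q \<in> {1..M} \<Longrightarrow> r \<le> dist_int (real q *\<^sub>R v)"
    and m: "m > 0" "real CARD('n) / real m \<le> r"
    and L: "m ^ CARD('n) < L * M"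
  obtains k :: int where "\<bar>k\<bar> \<le> 3 * int L * int M" "dist_int (w - of_int k *\<^sub>R v) \<le> 3 * real L * r"
proof -
  define A where "A i = {x. \<exists>k. \<bar>k\<bar> \<le> int i * int M \<and> dist_int (x - of_int k *\<^sub>R v) \<le> real i * r}" for i :: nat
  have A_mono: "A i \<subseteq> A j" if "i \<le> j" for i j
  proof -
    have "int i * int M \<le> int j * int M" "real i * r \<le> real j * r"
      using that r by (auto intro!: mult_right_mono)
    then show ?thesis unfolding A_def by (auto intro: order_trans)
  qed
  have A_near: "y \<in> A (Suc i)" if x: "x \<in> A i" and d: "dist_int (y - x) \<le> r" for x y i
  proof -
    obtain k where k: "\<bar>k\<bar> \<le> int i * int M" "dist_int (x - of_int k *\<^sub>R v) \<le> real i * r"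
      using x by (auto simp: A_def)
    have "dist_int (y - of_int k *\<^sub>R v) \<le> real (Suc i) * r"
      using dist_int_triangle[of "y - x" "x - of_int k *\<^sub>R v"] d k(2) by (simp add: algebra_simps)
    moreover have "\<bar>k\<bar> \<le> int (Suc i) * int M" using k(1) by (simp add: algebra_simps)
    ultimately show ?thesis unfolding A_def by blast
  qed
  have A_shift: "x + of_int l *\<^sub>R v \<in> A (Suc i)" if x: "x \<in> A i" and l: "\<bar>l\<bar> \<le> int M" for x l i
  proof -
    obtain k where k: "\<bar>k\<bar> \<le> int i * int M" "dist_int (x - of_int k *\<^sub>R v) \<le> real i * r"
      using x by (auto simp: A_def)
    have "x + of_int l *\<^sub>R v - of_int (k + l) *\<^sub>R v = x - of_int k *\<^sub>R v"
      by (simp add: algebra_simps)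
    then have "dist_int (x + of_int l *\<^sub>R v - of_int (k + l) *\<^sub>R v) \<le> real (Suc i) * r"
      using k(2) r by (simp add: algebra_simps)
    moreover have "\<bar>k + l\<bar> \<le> int (Suc i) * int M"
      using k(1) l abs_triangle_ineq[of k l] by (simp add: algebra_simps)
    ultimately show ?thesis unfolding A_def by blast
  qed
  have "w \<in> A (3 * L)"
  proof (rule ccontr)
    assume w: "w \<notin> A (3 * L)"
    obtain T :: nat where T: "norm w / r < real T" using reals_Archimedean2 by blast
    have T_pos: "real T > 0" using T r by (smt (verit) divide_nonneg_pos norm_ge_zero)
    (* The path is discretised so finely that each of its steps is a single move. *)
    define path where "path l = (real l / real T) *\<^sub>R w" for l :: nat
    have ends: "path 0 = 0" "path T = w" using T_pos by (auto simp: path_def)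
    have step: "dist_int (path (Suc l) - path l) \<le> r" for l
    proof -
      have "path (Suc l) - path l = (1 / real T) *\<^sub>R w"
        by (simp add: path_def flip: scaleR_diff_left) (simp add: diff_divide_distrib[symmetric])
      then have "dist_int (path (Suc l) - path l) \<le> norm w / real T"
        using dist_int_le_norm[of "(1 / real T) *\<^sub>R w"] by simp
      also have "\<dots> \<le> r" using T T_pos r by (simp add: field_simps)
      finally show ?thesis .
    qed
    have "\<exists>x. x \<in> A (Suc i) \<and> x \<notin> A i" if "i \<le> 3 * L" for i
    proof -
      have "path T \<notin> A i" using w A_mono[OF that] ends by auto
      moreover have "path 0 \<in> A i"
        using r dist_int_le_norm[of "0 :: real ^ 'n"] unfolding A_def ends
        by (auto intro!: exI[of _ 0] intro: order_trans)
      ultimately have "\<exists>l<T. (\<forall>l'\<le>l. \<not> path l' \<notin> A i) \<and> path (Suc l) \<notin> A i"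
        using ex_least_nat_less[of "\<lambda>l. path l \<notin> A i" T] by blast
      then obtain l where "path l \<in> A i" "path (Suc l) \<notin> A i" by blast
      with A_near[OF _ step] show ?thesis by blast
    qed
    then obtain x where x: "\<And>i. i \<le> 3 * L \<Longrightarrow> x i \<in> A (Suc i)" "\<And>i. i \<le> 3 * L \<Longrightarrow> x i \<notin> A i"
      by metis
    define f where "f = (\<lambda>(a, k). x (3 * a) + real k *\<^sub>R v)"
    (* Two translates of points from different shells cannot be close: the difference of the
       translations is one move and the remaining gap another. *)
    have sep': "r < dist_int (f (a, k) - f (a', k'))"
      if "a < a'" "a' < L" "k \<in> {1..M}" "k' \<in> {1..M}" for a k a' k'
    proof (rule ccontr)
      assume "\<not> ?thesis"
      moreover define y where "y = x (3 * a) + of_int (int k - int k') *\<^sub>R v"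
      have "x (3 * a') - y = - (f (a, k) - f (a', k'))"
        by (simp add: y_def f_def algebra_simps)
      ultimately have "dist_int (x (3 * a') - y) \<le> r" by (simp only: dist_int_minus not_less)
      moreover have "y \<in> A (Suc (Suc (3 * a)))"
        unfolding y_def using that by (intro A_shift x(1)) auto
      ultimately have "x (3 * a') \<in> A (Suc (Suc (Suc (3 * a))))" by (rule A_near[rotated])
      also have "\<dots> \<subseteq> A (3 * a')" using that by (intro A_mono) auto
      finally show False using x(2)[of "3 * a'"] that by auto
    qed
    have "card ({..<L} \<times> {1..M}) \<le> m ^ CARD('n)"
    proof (rule card_separated_mod_int_le[OF _ _ m, where f = f])
      fix p p' assume p: "p \<in> {..<L} \<times> {1..M}" "p' \<in> {..<L} \<times> {1..M}" "p \<noteq> p'"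
      obtain a k a' k' where pk: "p = (a, k)" "p' = (a', k')" by fastforce
      consider "a < a'" | "a' < a" | "a = a'" "k < k'" | "a = a'" "k' < k"
        using p pk by force
      then show "r \<le> dist_int (f p - f p')"
      proof cases
        case 1 then show ?thesis using sep'[of a a' k k'] p pk by auto
      next
        case 2
        then show ?thesis using sep'[of a' a k' k] p pk dist_int_minus[of "f p - f p'"] by auto
      next
        case 3
        then have "f p - f p' = - (real (k' - k) *\<^sub>R v)"
          by (simp add: pk f_def of_nat_diff algebra_simps)
        moreover have "k' - k \<in> {1..M}" using 3 p pk by auto
        ultimately show ?thesis using sep by (metis dist_int_minus)
      next
        case 4
        then have "f p - f p' = real (k - k') *\<^sub>R v"
          by (simp add: pk f_def of_nat_diff algebra_simps)
        moreover have "k - k' \<in> {1..M}" using 4 p pk by auto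
        ultimately show ?thesis using sep by metis
      qed
    qed simp
    then show False using L by (simp add: card_cartesian_product)
  qed
  then show ?thesis using that by (auto simp: A_def)
qed

section \<open>Measure of the resonant set\<close>

text \<open>
  In terms of Diophantine approximation: the vectors with a rational approximation \<open>p / q\<close> of
  denominator \<open>q \<le> M\<close> and error less than \<open>r / q\<close>.
\<close>

definition resonant :: "nat \<Rightarrow> real \<Rightarrow> (real ^ 'n) set" where
  "resonant M r = {v. \<exists>q\<in>{1..M}. dist_int (real q *\<^sub>R v) < r}"

lemma open_dist_int_multiple_less: "open {v :: real ^ 'n. dist_int (real q *\<^sub>R v) < r}"
  by (intro open_Collect_less continuous_on_const
      continuous_on_compose2[OF continuous_dist_int, of _ "\<lambda>v. real q *\<^sub>R v"] continuous_intros) auto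

lemma sets_dist_int_multiple_less: "{v :: real ^ 'n. dist_int (real q *\<^sub>R v) < r} \<in> sets lebesgue"
  using borel_open[OF open_dist_int_multiple_less, of q r] sets_completionI_sets[of _ lborel] by simp

lemma sets_resonant: "(resonant M r :: (real ^ 'n) set) \<in> sets lebesgue"
proof -
  have "(resonant M r :: (real ^ 'n) set) = (\<Union>q\<in>{1..M}. {v. dist_int (real q *\<^sub>R v) < r})"
    by (auto simp: resonant_def)
  then show ?thesis
    by (simp only:) (intro sets.finite_UN finite_atLeastAtMost sets_dist_int_multiple_less)
qed

lemma card_int_interval_le:
  fixes x y :: real
  assumes "x \<le> y"
  shows "real (card {\<lceil>x\<rceil>..\<lfloor>y\<rfloor>}) \<le> y - x + 1"
  using assms unfolding card_atLeastAtMost_int by linarith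

text \<open>
  The set lies in the union of the cubes of side \<open>2 r / q\<close> about the points \<open>p / q\<close> with \<open>p\<close>
  integral, of which at most \<open>\<Prod>\<^sub>i (q (b\<^sub>i - a\<^sub>i) + 2)\<close> meet the box.
\<close>

lemma measure_dist_int_multiple_less:
  fixes a b :: "real ^ 'n"
  assumes q: "q \<ge> 1" and r: "0 < r" "r \<le> 1 / 2" and ab: "\<And>i. a $ i < b $ i"
  shows "measure lebesgue ({v. dist_int (real q *\<^sub>R v) < r} \<inter> cbox a b)
       \<le> (\<Prod>i\<in>UNIV. 2 * r * (b $ i - a $ i + 2 / real q))"
proof -
  define I where "I i = {\<lceil>real q * a $ i - r\<rceil>..\<lfloor>real q * b $ i + r\<rfloor>}" for i
  define P where "P = (\<Pi>\<^sub>E i\<in>UNIV. I i)"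
  define K :: "('n \<Rightarrow> int) \<Rightarrow> (real ^ 'n) set" where
    "K p = cbox (\<chi> i. (p i - r) / q) (\<chi> i. (p i + r) / q)" for p
  have finP: "finite P" unfolding P_def I_def by (intro finite_PiE) auto
  have "{v. dist_int (real q *\<^sub>R v) < r} \<inter> cbox a b \<subseteq> (\<Union>p\<in>P. K p)"
  proof
    fix v assume v: "v \<in> {v. dist_int (real q *\<^sub>R v) < r} \<inter> cbox a b"
    then obtain z where z: "z \<in> int_lattice" "dist (real q *\<^sub>R v) z < r"
      using dist_int_less_obtain by blast
    define p where "p i = \<lfloor>z $ i\<rfloor>" for i
    have zp: "z $ i = p i" for i using z(1) by (auto simp: p_def int_lattice_def)
    have close: "\<bar>real q * v $ i - p i\<bar> < r" for i
      using z(2) component_le_norm_cart[of "real q *\<^sub>R v - z" i] by (simp add: dist_norm zp)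
    have qv: "real q * a $ i \<le> real q * v $ i" "real q * v $ i \<le> real q * b $ i" for i
      using v by (auto simp: mem_box_cart intro!: mult_left_mono)
    have "p i \<in> I i" for i
      unfolding I_def using close[of i] qv[of i] by (auto simp: ceiling_le_iff le_floor_iff abs_less_iff)
    then have "p \<in> P" by (auto simp: P_def)
    moreover have "v \<in> K p"
      unfolding K_def mem_box_cart using close q by (auto simp: field_simps abs_less_iff less_imp_le)
    ultimately show "v \<in> (\<Union>p\<in>P. K p)" by blast
  qed
  then have "measure lebesgue ({v. dist_int (real q *\<^sub>R v) < r} \<inter> cbox a b) \<le> measure lebesgue (\<Union>p\<in>P. K p)"
    using finP sets_dist_int_multiple_less
    by (intro measure_mono_fmeasurable fmeasurable.finite_UN) (auto simp: K_def intro!: sets.Int)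
  also have "\<dots> \<le> (\<Sum>p\<in>P. measure lebesgue (K p))"
    using finP by (intro measure_UNION_le) (auto simp: K_def)
  also have "\<dots> = (\<Sum>p\<in>P. \<Prod>i\<in>(UNIV :: 'n set). 2 * r / q)"
  proof (rule sum.cong[OF refl])
    fix p
    have "K p \<noteq> {}" using q r unfolding K_def by (auto simp: interval_ne_empty_cart divide_right_mono)
    then have "measure lebesgue (K p) = (\<Prod>i\<in>UNIV. (p i + r) / q - (p i - r) / q)"
      unfolding K_def by (simp add: content_cbox_cart)
    also have "\<dots> = (\<Prod>i\<in>(UNIV :: 'n set). 2 * r / q)" by (simp add: diff_divide_distrib[symmetric])
    finally show "measure lebesgue (K p) = (\<Prod>i\<in>(UNIV :: 'n set). 2 * r / q)" .
  qed
  also have "\<dots> = (\<Prod>i\<in>UNIV. real (card (I i)) * (2 * r / q))"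
    by (simp only: P_def card_PiE[OF finite] prod.distrib sum_constant of_nat_prod)
  also have "\<dots> \<le> (\<Prod>i\<in>UNIV. 2 * r * (b $ i - a $ i + 2 / real q))"
  proof (rule prod_mono, intro conjI)
    fix i :: 'n
    have le: "real q * a $ i - r \<le> real q * b $ i + r"
      using r mult_left_mono[OF less_imp_le[OF ab[of i]], of "real q"] by simp
    have "real (card (I i)) \<le> real q * (b $ i - a $ i) + 2"
      using card_int_interval_le[OF le] r unfolding I_def by (simp add: algebra_simps)
    then have "real (card (I i)) * (2 * r / q) \<le> (real q * (b $ i - a $ i) + 2) * (2 * r / q)"
      using r by (intro mult_right_mono) auto
    also have "\<dots> = 2 * r * (b $ i - a $ i + 2 / real q)" using q by (simp add: field_simps)
    finally show "real (card (I i)) * (2 * r / q) \<le> 2 * r * (b $ i - a $ i + 2 / real q)" .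
  qed (use r in auto)
  finally show ?thesis .
qed

text \<open>
  For \<open>q\<close> above \<open>2\<close> divided by the shortest side of the box, the points \<open>p / q\<close> are so dense that
  their number is governed by the volume of the box. The finitely many smaller \<open>q\<close> go into the
  constant \<open>C\<close>, whose term is negligible as \<open>r\<close> tends to \<open>0\<close>.
\<close>

lemma measure_resonant_le:
  fixes a b :: "real ^ 'n"
  assumes "box a b \<noteq> {}"
  shows "\<exists>C. \<forall>M r. 0 < r \<longrightarrow> r \<le> 1 / 2 \<longrightarrow>
    measure lebesgue (resonant M r \<inter> cbox a b)
      \<le> real M * (4 * r) ^ CARD('n) * measure lebesgue (cbox a b) + C * r ^ CARD('n)"
proof -
  have ab: "a $ i < b $ i" for i using assms by (auto simp: interval_ne_empty_cart)
  define s where "s = Min (range (\<lambda>i. b $ i - a $ i))"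
  have s: "0 < s" "s \<le> b $ i - a $ i" for i
    using ab by (auto simp: s_def)
  obtain q0 :: nat where q0: "2 / s < real q0" using reals_Archimedean2 by blast
  have q0_pos: "real q0 > 0" using q0 s(1) by (smt (verit) divide_pos_pos)
  define C where "C = (\<Prod>i\<in>UNIV. 2 * (b $ i - a $ i + 2))"
  have C: "C \<ge> 0" unfolding C_def
    using ab by (intro prod_nonneg ballI mult_nonneg_nonneg add_nonneg_nonneg) (auto intro: less_imp_le)
  have mQ: "measure lebesgue (cbox a b) = (\<Prod>i\<in>UNIV. b $ i - a $ i)"
    using ab by (simp add: content_cbox_if_cart interval_eq_empty_cart not_less_iff_gr_or_eq) (metis less_asym)
  show ?thesis
  proof (intro exI[of _ "real q0 * C"] allI impI)
    fix M and r :: real assume r: "0 < r" "r \<le> 1 / 2"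
    let ?E = "\<lambda>q. {v. dist_int (real q *\<^sub>R v) < r} \<inter> cbox a b"
    have large: "measure lebesgue (?E q) \<le> (4 * r) ^ CARD('n) * measure lebesgue (cbox a b)" if "q \<ge> q0" for q
    proof -
      have "real q0 \<le> real q" using that by simp
      with q0 have q: "2 / s < real q" by linarith
      have "q \<ge> 1" using that q0_pos by auto
      then have "measure lebesgue (?E q) \<le> (\<Prod>i\<in>UNIV. 2 * r * (b $ i - a $ i + 2 / real q))"
        using measure_dist_int_multiple_less ab r by blast
      also have "\<dots> \<le> (\<Prod>i\<in>UNIV. 4 * r * (b $ i - a $ i))"
      proof (rule prod_mono, intro conjI)
        fix i :: 'n
        have "2 / real q \<le> s" using q s(1) \<open>q \<ge> 1\<close> by (simp add: field_simps)
        from order_trans[OF this s(2)[of i]] have "b $ i - a $ i + 2 / real q \<le> 2 * (b $ i - a $ i)" by simp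
        from mult_left_mono[OF this, of "2 * r"] r
        show "2 * r * (b $ i - a $ i + 2 / real q) \<le> 4 * r * (b $ i - a $ i)" by simp
        show "0 \<le> 2 * r * (b $ i - a $ i + 2 / real q)"
          using ab[of i] r by (intro mult_nonneg_nonneg add_nonneg_nonneg) auto
      qed
      also have "\<dots> = (4 * r) ^ CARD('n) * measure lebesgue (cbox a b)"
        by (simp only: prod.distrib mQ prod_constant power_mult_distrib)
      finally show ?thesis .
    qed
    have small: "measure lebesgue (?E q) \<le> C * r ^ CARD('n)" if "q \<ge> 1" for q
    proof -
      have "measure lebesgue (?E q) \<le> (\<Prod>i\<in>UNIV. 2 * r * (b $ i - a $ i + 2 / real q))"
        using measure_dist_int_multiple_less ab r that by blast
      also have "\<dots> \<le> (\<Prod>i\<in>UNIV. 2 * (b $ i - a $ i + 2) * r)"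
      proof (rule prod_mono, intro conjI)
        fix i :: 'n
        have "2 / real q \<le> 2" using that by (simp add: field_simps)
        then have "b $ i - a $ i + 2 / real q \<le> b $ i - a $ i + 2" by simp
        from mult_left_mono[OF this, of "2 * r"] r
        show "2 * r * (b $ i - a $ i + 2 / real q) \<le> 2 * (b $ i - a $ i + 2) * r" by (simp add: mult_ac)
        show "0 \<le> 2 * r * (b $ i - a $ i + 2 / real q)"
          using ab[of i] r by (intro mult_nonneg_nonneg add_nonneg_nonneg) auto
      qed
      also have "\<dots> = C * r ^ CARD('n)" by (simp only: prod.distrib C_def prod_constant)
      finally show ?thesis .
    qed
    have "resonant M r \<inter> cbox a b = (\<Union>q\<in>{1..M}. ?E q)" by (auto simp: resonant_def)
    then have "measure lebesgue (resonant M r \<inter> cbox a b) \<le> (\<Sum>q\<in>{1..M}. measure lebesgue (?E q))"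
      using sets_dist_int_multiple_less
      by (simp only:) (intro measure_UNION_le, auto intro!: sets.Int)
    also have "\<dots> \<le> (\<Sum>q\<in>{1..M}. (4 * r) ^ CARD('n) * measure lebesgue (cbox a b)
        + (if q < q0 then C * r ^ CARD('n) else 0))"
    proof (rule sum_mono)
      fix q assume q: "q \<in> {1..M}"
      have "0 \<le> (4 * r) ^ CARD('n) * measure lebesgue (cbox a b)" using r by simp
      then show "measure lebesgue (?E q) \<le> (4 * r) ^ CARD('n) * measure lebesgue (cbox a b)
          + (if q < q0 then C * r ^ CARD('n) else 0)"
        using large[of q] small[of q] q by (cases "q < q0") (auto simp del: measure_completion)
    qed
    also have "\<dots> = real M * (4 * r) ^ CARD('n) * measure lebesgue (cbox a b)
        + (\<Sum>q\<in>{1..M}. if q < q0 then C * r ^ CARD('n) else 0)"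
      by (simp add: sum.distrib)
    also have "(\<Sum>q\<in>{1..M}. if q < q0 then C * r ^ CARD('n) else 0) \<le> (\<Sum>q<q0. C * r ^ CARD('n))"
      unfolding sum.inter_filter[OF finite_atLeastAtMost, symmetric]
      using C r by (intro sum_mono2) auto
    finally show "measure lebesgue (resonant M r \<inter> cbox a b)
      \<le> real M * (4 * r) ^ CARD('n) * measure lebesgue (cbox a b) + (real q0 * C) * r ^ CARD('n)"
      by simp
  qed
qed

text \<open>
  For \<open>M = T\<^sup>n\<close> and \<open>r = 1 / (64 T)\<close> the main term \<open>M (4 r)\<^sup>n\<close> is \<open>16\<^sup>-\<^sup>n\<close>, independently of \<open>T\<close>.
  This leaves another sixteenth of the volume for the error term.
\<close>

lemma eventually_measure_resonant_le:
  fixes a b :: "real ^ 'n"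
  assumes ne: "box a b \<noteq> {}" and D: "D \<ge> 1" and \<beta>: "\<beta> \<ge> 2"
  shows "\<forall>\<^sub>F j in sequentially.
    measure lebesgue (resonant ((D * \<beta> ^ j) ^ CARD('n)) (1 / (64 * real (D * \<beta> ^ j))) \<inter> cbox a b)
      \<le> measure lebesgue (cbox a b) / 8"
proof -
  obtain C where C: "\<And>M r. \<lbrakk>0 < r; r \<le> 1 / 2\<rbrakk> \<Longrightarrow>
    measure lebesgue (resonant M r \<inter> cbox a b)
      \<le> real M * (4 * r) ^ CARD('n) * measure lebesgue (cbox a b) + C * r ^ CARD('n)"
    using measure_resonant_le[OF ne] by blast
  define \<mu> where "\<mu> = measure lebesgue (cbox a b)"
  have \<mu>: "\<mu> > 0" using ne content_pos_lt_eq[of a b] by (auto simp: \<mu>_def box_ne_empty)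
  have "(\<lambda>j. \<bar>C\<bar> * (1 / 2) ^ j) \<longlonglongrightarrow> \<bar>C\<bar> * 0"
    by (intro tendsto_mult tendsto_const LIMSEQ_power_zero) auto
  then have "\<forall>\<^sub>F j in sequentially. \<bar>C\<bar> * (1 / 2) ^ j < \<mu> / 16"
    using \<mu> by (intro order_tendstoD) auto
  then show ?thesis
  proof eventually_elim
    fix j assume j: "\<bar>C\<bar> * (1 / 2) ^ j < \<mu> / 16"
    define T where "T = real (D * \<beta> ^ j)"
    define r where "r = 1 / (64 * T)"
    have "(2::real) ^ j \<le> real \<beta> ^ j" using \<beta> by (intro power_mono) auto
    also have "\<dots> \<le> T" using D by (simp add: T_def mult_le_cancel_right1)
    finally have T: "2 ^ j \<le> T" .
    moreover have "(1::real) \<le> 2 ^ j" by simp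
    ultimately have T1: "1 \<le> T" by linarith
    have r: "0 < r" "r \<le> 1 / 2" "r \<le> (1 / 2) ^ j"
      using T T1 by (auto simp: r_def field_simps power_divide)
    have "real ((D * \<beta> ^ j) ^ CARD('n)) * (4 * r) ^ CARD('n) = (T * (4 * r)) ^ CARD('n)"
      by (simp add: T_def power_mult_distrib)
    also have "T * (4 * r) = 1 / 16" using T1 by (simp add: r_def)
    also have "(1 / 16 :: real) ^ CARD('n) \<le> (1 / 16) ^ 1" by (rule power_decreasing) (auto simp: Suc_leI)
    finally have main: "real ((D * \<beta> ^ j) ^ CARD('n)) * (4 * r) ^ CARD('n) \<le> 1 / 16" by simp
    have "r ^ CARD('n) \<le> r ^ 1" using r by (intro power_decreasing) (auto simp: Suc_leI)
    then have "C * r ^ CARD('n) \<le> \<bar>C\<bar> * (1 / 2) ^ j"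
      using r by (intro mult_mono) auto
    moreover have "real ((D * \<beta> ^ j) ^ CARD('n)) * (4 * r) ^ CARD('n) * \<mu> \<le> 1 / 16 * \<mu>"
      using main \<mu> by (intro mult_right_mono) auto
    ultimately show "measure lebesgue (resonant ((D * \<beta> ^ j) ^ CARD('n)) (1 / (64 * real (D * \<beta> ^ j))) \<inter> cbox a b)
      \<le> measure lebesgue (cbox a b) / 8"
      using C[OF r(1,2), of "(D * \<beta> ^ j) ^ CARD('n)"] j unfolding \<mu>_def[symmetric] r_def T_def by linarith
  qed
qed

section \<open>Almost every point avoids half of the resonances\<close>

text \<open>
  A weak form of the Lebesgue density theorem. Cover a bounded piece of \<open>F\<close> by boxes with
  disjoint interiors whose total volume exceeds the measure of the piece by \<open>e\<close> at most. Since
  \<open>F\<close> fills half of each box at most, the measure \<open>\<mu>\<close> of the piece satisfies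
  \<open>\<mu> \<le> (\<mu> + e) / 2\<close> for every \<open>e > 0\<close>.
\<close>

lemma negligible_if_half_in_boxes:
  fixes F :: "'a::euclidean_space set"
  assumes F: "F \<in> sets lebesgue"
    and half: "\<And>a b. box a b \<noteq> {} \<Longrightarrow>
      measure lebesgue (F \<inter> cbox a b) \<le> measure lebesgue (cbox a b) / 2"
  shows "negligible F"
  unfolding negligible_on_intervals[of F]
proof (intro allI)
  fix a b
  define S where "S = F \<inter> cbox a b"
  have S: "S \<in> lmeasurable"
    unfolding S_def using F by (metis Int_commute fmeasurable_Int_fmeasurable lmeasurable_cbox)
  have S_sub: "S \<subseteq> cbox a b" by (simp add: S_def)
  have "measure lebesgue S = 0" if ne: "box a b \<noteq> {}"
  proof -
    have half_S: "measure lebesgue S \<le> (measure lebesgue S + e) / 2" if e: "e > 0" for e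
    proof -
      obtain \<D> where cD: "countable \<D>"
        and D: "\<And>K. K \<in> \<D> \<Longrightarrow> K \<subseteq> cbox a b \<and> K \<noteq> {} \<and> (\<exists>c d. K = cbox c d)"
        and disj: "pairwise (\<lambda>A B. interior A \<inter> interior B = {}) \<D>"
        and "\<And>u v. cbox u v \<in> \<D> \<Longrightarrow> \<exists>n. \<forall>i \<in> Basis. v \<bullet> i - u \<bullet> i = (b \<bullet> i - a \<bullet> i)/2^n"
        and int: "\<And>K. \<lbrakk>K \<in> \<D>; box a b \<noteq> {}\<rbrakk> \<Longrightarrow> interior K \<noteq> {}"
        and cov: "S \<subseteq> \<Union>\<D>" "\<Union>\<D> \<in> lmeasurable" "measure lebesgue (\<Union>\<D>) \<le> measure lebesgue S + e"
        apply (rule measurable_outer_intervals_bounded[OF S S_sub e])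
        subgoal premises prems for \<D>
          by (rule prems(1)[of \<D>]) (fact prems)+
        done
      have disj': "disjoint_family_on interior \<D>"
        using disj by (auto simp: disjoint_family_on_def pairwise_def)
      (* The boxes overlap in their boundaries, so additivity is applied to the interiors. *)
      have "emeasure lebesgue S \<le> emeasure lebesgue (\<Union>K\<in>\<D>. S \<inter> interior K)"
      proof -
        have "S - (\<Union>K\<in>\<D>. S \<inter> interior K) \<subseteq> (\<Union>K\<in>\<D>. K - interior K)"
          using cov by auto
        moreover have "negligible (\<Union>K\<in>\<D>. K - interior K)"
          using cD D by (intro negligible_countable_Union)
            (auto dest!: D simp: negligible_frontier_interval)
        ultimately have "negligible (S - (\<Union>K\<in>\<D>. S \<inter> interior K))"
          using negligible_subset by blast
        moreover have m: "(\<Union>K\<in>\<D>. S \<inter> interior K) \<in> sets lebesgue"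
          using cD S by (intro sets.countable_UN') (auto intro!: sets.Int)
        ultimately have "emeasure lebesgue ((\<Union>K\<in>\<D>. S \<inter> interior K) \<union> (S - (\<Union>K\<in>\<D>. S \<inter> interior K)))
           = emeasure lebesgue (\<Union>K\<in>\<D>. S \<inter> interior K)"
          by (intro emeasure_Un_null_set) (auto simp: negligible_iff_null_sets)
        moreover have "(\<Union>K\<in>\<D>. S \<inter> interior K) \<union> (S - (\<Union>K\<in>\<D>. S \<inter> interior K)) = S" by auto
        ultimately show ?thesis by simp
      qed
      also have "\<dots> = (\<integral>\<^sup>+K. emeasure lebesgue (S \<inter> interior K) \<partial>count_space \<D>)"
        using cD S disj' by (intro emeasure_UN_countable)
          (auto simp: disjoint_family_on_def intro!: sets.Int)
      also have "\<dots> \<le> (\<integral>\<^sup>+K. ennreal (1/2) * emeasure lebesgue (interior K) \<partial>count_space \<D>)"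
      proof (intro nn_integral_mono, simp only: space_count_space)
        fix K assume K: "K \<in> \<D>"
        then obtain c d where cd: "K = cbox c d" using D by blast
        have "emeasure lebesgue (S \<inter> interior K) \<le> emeasure lebesgue (F \<inter> cbox c d)"
          using F unfolding S_def cd by (intro emeasure_mono) (auto intro!: sets.Int box_subset_cbox[THEN subsetD])
        also have "\<dots> = ennreal (measure lebesgue (F \<inter> cbox c d))"
          using F by (intro emeasure_eq_measure2)
            (metis Int_commute fmeasurable_Int_fmeasurable lmeasurable_cbox)
        also have "\<dots> \<le> ennreal (1/2 * measure lebesgue (cbox c d))"
          using half[of c d] int[OF K ne] unfolding cd by (intro ennreal_leI) simp
        also have "\<dots> = ennreal (1/2) * ennreal (measure lebesgue (cbox c d))"
          by (rule ennreal_mult) auto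
        also have "measure lebesgue (cbox c d) = measure lebesgue (box c d)"
          by (simp add: measure_completion content_cbox' measure_lborel_box_eq measure_lborel_cbox_eq box_ne_empty)
        also have "ennreal (measure lebesgue (box c d)) = emeasure lebesgue (interior K)"
          unfolding cd by (subst emeasure_eq_measure2) auto
        finally show "emeasure lebesgue (S \<inter> interior K)
            \<le> ennreal (1/2) * emeasure lebesgue (interior K)" .
      qed
      also have "\<dots> = ennreal (1/2) * (\<integral>\<^sup>+K. emeasure lebesgue (interior K) \<partial>count_space \<D>)"
        by (rule nn_integral_cmult) auto
      also have "(\<integral>\<^sup>+K. emeasure lebesgue (interior K) \<partial>count_space \<D>) = emeasure lebesgue (\<Union>K\<in>\<D>. interior K)"
        using cD disj' by (intro emeasure_UN_countable[symmetric]) auto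
      also have "\<dots> \<le> emeasure lebesgue (\<Union>\<D>)"
        using cov by (intro emeasure_mono) (auto intro: interior_subset[THEN subsetD])
      also have "ennreal (1/2) * emeasure lebesgue (\<Union>\<D>) = ennreal (1/2 * measure lebesgue (\<Union>\<D>))"
        unfolding emeasure_eq_measure2[OF cov(2)] by (rule ennreal_mult[symmetric]) auto
      finally have "ennreal (measure lebesgue S) \<le> ennreal (1/2 * measure lebesgue (\<Union>\<D>))"
        using S by (simp add: emeasure_eq_measure2 mult_left_mono)
      then have "measure lebesgue S \<le> 1/2 * measure lebesgue (\<Union>\<D>)"
        by (subst (asm) ennreal_le_iff) auto
      with cov show ?thesis by simp
    qed
    show ?thesis
    proof (rule ccontr)
      assume "measure lebesgue S \<noteq> 0"
      then have pos: "measure lebesgue S / 2 > 0" using measure_nonneg[of lebesgue S] by linarith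
      with half_S[OF pos] show False by (simp add: field_simps)
    qed
  qed
  then have "box a b \<noteq> {} \<Longrightarrow> negligible S"
    using S by (simp add: negligible_iff_measure)
  moreover have "box a b = {} \<Longrightarrow> negligible S"
    using negligible_subset[of "cbox a b" S] by (auto simp: S_def negligible_interval)
  ultimately show "negligible (F \<inter> cbox a b)" unfolding S_def by blast
qed

text \<open>
  The exceptional set is the union over \<open>m\<close> of the sets \<open>F m\<close> of points that lie in more than
  half of the \<open>B j\<close> with \<open>j < J\<close>, for all \<open>J \<ge> m\<close>. By Markov's inequality for the counting
  function and a single large \<open>J\<close>, the measure of \<open>F m\<close> in a box \<open>Q\<close> is at most \<open>2 / J\<close> times the
  sum of the measures of \<open>B j \<inter> Q\<close>, and so at most half of that of \<open>Q\<close>.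
\<close>

lemma AE_frequently_few_hits:
  fixes B :: "nat \<Rightarrow> 'a::euclidean_space set"
  assumes B: "\<And>j. B j \<in> sets lebesgue"
    and small: "\<And>a b. box a b \<noteq> {} \<Longrightarrow> \<forall>\<^sub>F j in sequentially.
      measure lebesgue (B j \<inter> cbox a b) \<le> measure lebesgue (cbox a b) / 8"
  shows "AE x in lebesgue. \<exists>\<^sub>F J in sequentially. 2 * card {j. j < J \<and> x \<in> B j} \<le> J"
proof -
  define hits where "hits J x = (\<Sum>j<J. indicat_real (B j) x)" for J x
  have hits: "real (card {j. j < J \<and> x \<in> B j}) = hits J x" for J x
  proof -
    have "hits J x = (\<Sum>j | j < J \<and> x \<in> B j. 1)"
      unfolding hits_def by (rule sum.mono_neutral_cong_right) (auto simp: indicator_def)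
    then show ?thesis by simp
  qed
  have [measurable]: "B j \<in> sets lebesgue" for j by (rule B)
  have hm [measurable]: "hits J \<in> borel_measurable lebesgue" for J
    unfolding hits_def by measurable
  define F where "F m = {x. \<forall>J\<ge>m. real J < 2 * hits J x}" for m
  have Fm [measurable]: "F m \<in> sets lebesgue" for m
  proof -
    have "F m = {x \<in> space lebesgue. \<forall>J\<in>{m..}. real J < 2 * hits J x}" by (auto simp: F_def)
    also have "\<dots> \<in> sets lebesgue" by measurable
    finally show ?thesis .
  qed
  have "negligible (F m)" for m
  proof (rule negligible_if_half_in_boxes[OF Fm])
    fix a b :: 'a assume ne: "box a b \<noteq> {}"
    let ?\<mu> = "measure lebesgue" and ?Q = "cbox a b"
    obtain j0 where j0: "\<And>j. j \<ge> j0 \<Longrightarrow> ?\<mu> (B j \<inter> ?Q) \<le> ?\<mu> ?Q / 8"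
      using small[OF ne] by (auto simp: eventually_sequentially)
    have BQ: "B j \<inter> ?Q \<in> lmeasurable" for j
      using B by (metis Int_commute fmeasurable_Int_fmeasurable lmeasurable_cbox)
    have FQ: "F m \<inter> ?Q \<in> lmeasurable"
      using Fm by (metis Int_commute fmeasurable_Int_fmeasurable lmeasurable_cbox)
    have le: "?\<mu> (B j \<inter> ?Q) \<le> ?\<mu> ?Q" for j
      using BQ[of j] by (intro measure_mono_fmeasurable) auto
    (* The indices below j0 carry no bound beyond the volume of Q. With J at least 8 * j0 they
       contribute no more than the remaining ones. *)
    define J where "J = m + 8 * j0 + 1"
    have "real J * ?\<mu> (F m \<inter> ?Q) = (\<integral>x. real J * indicator (F m \<inter> ?Q) x \<partial>lebesgue)"
      using FQ by (simp add: lmeasurable_iff_integrable)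
    also have "\<dots> \<le> (\<integral>x. 2 * (\<Sum>j<J. indicator (B j \<inter> ?Q) x) \<partial>lebesgue)"
    proof (rule integral_mono)
      fix x
      show "real J * indicator (F m \<inter> ?Q) x \<le> 2 * (\<Sum>j<J. indicator (B j \<inter> ?Q) x)"
      proof (cases "x \<in> F m \<inter> ?Q")
        case True
        then have "\<forall>J\<ge>m. real J < 2 * hits J x" by (auto simp: F_def)
        then have "real J < 2 * hits J x" using J_def by (meson le_add1 trans_le_add1)
        with True show ?thesis by (simp add: hits_def indicator_inter_arith)
      qed (auto intro!: sum_nonneg)
    qed (use FQ BQ in \<open>auto simp: lmeasurable_iff_integrable\<close>)
    also have "\<dots> = 2 * (\<Sum>j<J. ?\<mu> (B j \<inter> ?Q))"
      using BQ by (simp add: lmeasurable_iff_integrable)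
    also have "(\<Sum>j<J. ?\<mu> (B j \<inter> ?Q)) \<le> (\<Sum>j<J. (if j < j0 then ?\<mu> ?Q else 0) + ?\<mu> ?Q / 8)"
    proof (rule sum_mono)
      fix j show "?\<mu> (B j \<inter> ?Q) \<le> (if j < j0 then ?\<mu> ?Q else 0) + ?\<mu> ?Q / 8"
      proof (cases "j < j0")
        case True
        have "0 \<le> ?\<mu> ?Q" by (rule measure_nonneg)
        with True le[of j] show ?thesis unfolding if_P[OF True] by linarith
      next
        case False
        with j0[of j] show ?thesis unfolding if_not_P[OF False] by linarith
      qed
    qed
    also have "\<dots> = (\<Sum>j<J. if j < j0 then ?\<mu> ?Q else 0) + real J * ?\<mu> ?Q / 8"
      by (simp add: sum.distrib)
    also have "(\<Sum>j<J. if j < j0 then ?\<mu> ?Q else 0) = (\<Sum>j<j0. ?\<mu> ?Q)"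
      by (rule sum.mono_neutral_cong_right) (auto simp: J_def)
    also have "\<dots> = real j0 * ?\<mu> ?Q" by simp
    also have "real j0 * ?\<mu> ?Q \<le> real J * ?\<mu> ?Q / 8"
      using mult_right_mono[of "8 * real j0" "real J" "?\<mu> ?Q"] by (simp add: J_def)
    finally have "real J * ?\<mu> (F m \<inter> ?Q) \<le> real J * (?\<mu> ?Q / 2)" by simp
    then show "?\<mu> (F m \<inter> ?Q) \<le> ?\<mu> ?Q / 2"
      by (rule mult_left_le_imp_le) (simp add: J_def)
  qed
  then have "(\<Union>m. F m) \<in> null_sets lebesgue"
    using negligible_Union_nat negligible_iff_null_sets by blast
  moreover have "{x \<in> space lebesgue. \<not> (\<exists>\<^sub>F J in sequentially. 2 * card {j. j < J \<and> x \<in> B j} \<le> J)}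
      \<subseteq> (\<Union>m. F m)"
  proof clarify
    fix x assume "\<not> (\<exists>\<^sub>F J in sequentially. 2 * card {j. j < J \<and> x \<in> B j} \<le> J)"
    then obtain m where m: "\<And>J. J \<ge> m \<Longrightarrow> J < 2 * card {j. j < J \<and> x \<in> B j}"
      by (auto simp: not_frequently eventually_sequentially not_le)
    have "real J < 2 * hits J x" if "J \<ge> m" for J
      using m[OF that] hits[of J x] by linarith
    then show "x \<in> (\<Union>m. F m)" by (auto simp: F_def)
  qed
  ultimately show ?thesis by (rule AE_I')
qed

section \<open>Sets of Hausdorff measure zero\<close>

lemma hausdorff_measure_eq_0_iff:
  "hausdorff_measure s A = 0 \<longleftrightarrow>
    (\<forall>r>0. \<forall>e>0. \<exists>U :: nat \<Rightarrow> 'a::metric_space set. A \<subseteq> (\<Union>i. U i) \<and>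
      (\<forall>i. bounded (U i) \<and> diameter (U i) \<le> r) \<and> (\<Sum>i. ennreal (diam_powr s (U i))) \<le> ennreal e)"
    (is "?L \<longleftrightarrow> ?R")
proof
  assume L: ?L
  show ?R
  proof (intro allI impI)
    fix r e :: real assume re: "r > 0" "e > 0"
    have "hausdorff_premeasure s r A \<le> hausdorff_measure s A"
      unfolding hausdorff_measure_def using re by (intro SUP_upper) auto
    then have "hausdorff_premeasure s r A < ennreal e" using L re by simp
    then show "\<exists>U :: nat \<Rightarrow> 'a::metric_space set. A \<subseteq> (\<Union>i. U i) \<and>
      (\<forall>i. bounded (U i) \<and> diameter (U i) \<le> r) \<and> (\<Sum>i. ennreal (diam_powr s (U i))) \<le> ennreal e"
      unfolding hausdorff_premeasure_def INF_less_iff by (auto intro: less_imp_le)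
  qed
next
  assume R: ?R
  have "hausdorff_premeasure s r A = 0" if "r > 0" for r
  proof -
    have "hausdorff_premeasure s r A \<le> 0 + ennreal e" if "e > 0" for e
    proof -
      obtain U :: "nat \<Rightarrow> 'a set" where "A \<subseteq> (\<Union>i. U i)" "\<forall>i. bounded (U i) \<and> diameter (U i) \<le> r"
         "(\<Sum>i. ennreal (diam_powr s (U i))) \<le> ennreal e"
        using R \<open>r > 0\<close> \<open>e > 0\<close> by blast
      then show ?thesis unfolding hausdorff_premeasure_def by (auto intro!: INF_lower2[of U])
    qed
    then have "hausdorff_premeasure s r A \<le> 0" by (rule ennreal_le_epsilon)
    then show ?thesis by simp
  qed
  then show ?L unfolding hausdorff_measure_def by (auto intro!: SUP_eq_const)
qed

lemma hausdorff_measure_0_mono: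
  assumes "hausdorff_measure s B = 0" "A \<subseteq> B"
  shows "hausdorff_measure s A = 0"
  unfolding hausdorff_measure_eq_0_iff
proof (intro allI impI)
  fix r e :: real assume "r > 0" "e > 0"
  then obtain U :: "nat \<Rightarrow> 'a set" where U: "B \<subseteq> (\<Union>i. U i)"
      "\<forall>i. bounded (U i) \<and> diameter (U i) \<le> r" "(\<Sum>i. ennreal (diam_powr s (U i))) \<le> ennreal e"
    using assms(1) unfolding hausdorff_measure_eq_0_iff by blast
  have "A \<subseteq> (\<Union>i. U i)" using assms(2) U(1) by (rule order_trans)
  with U(2,3) show "\<exists>U :: nat \<Rightarrow> 'a set. A \<subseteq> (\<Union>i. U i) \<and>
      (\<forall>i. bounded (U i) \<and> diameter (U i) \<le> r) \<and> (\<Sum>i. ennreal (diam_powr s (U i))) \<le> ennreal e"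
    by blast
qed

lemma hausdorff_measure_0_countable_Union:
  fixes A :: "nat \<Rightarrow> 'a::metric_space set"
  assumes "\<And>i. hausdorff_measure s (A i) = 0"
  shows "hausdorff_measure s (\<Union>i. A i) = 0"
  unfolding hausdorff_measure_eq_0_iff
proof (intro allI impI)
  fix r e :: real assume re: "r > 0" "e > 0"
  have "\<exists>U :: nat \<Rightarrow> 'a set. A i \<subseteq> (\<Union>j. U j) \<and> (\<forall>j. bounded (U j) \<and> diameter (U j) \<le> r) \<and>
      (\<Sum>j. ennreal (diam_powr s (U j))) \<le> ennreal (e * (1 / 2) ^ Suc i)" for i
  proof -
    have "0 < e * (1 / 2) ^ Suc i" using re by simp
    with assms[of i] re(1) show ?thesis unfolding hausdorff_measure_eq_0_iff by blast
  qed
  then obtain U :: "nat \<Rightarrow> nat \<Rightarrow> 'a set" where U: "\<And>i. A i \<subseteq> (\<Union>j. U i j)"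
      "\<And>i j. bounded (U i j) \<and> diameter (U i j) \<le> r"
      "\<And>i. (\<Sum>j. ennreal (diam_powr s (U i j))) \<le> ennreal (e * (1 / 2) ^ Suc i)"
    by metis
  define V where "V k = case_prod U (prod_decode k)" for k
  have "(\<Union>i. A i) \<subseteq> (\<Union>k. V k)"
  proof
    fix x assume "x \<in> (\<Union>i. A i)"
    then obtain i j where "x \<in> U i j" using U(1) by blast
    then have "x \<in> V (prod_encode (i, j))" by (simp add: V_def)
    then show "x \<in> (\<Union>k. V k)" by blast
  qed
  moreover have "\<forall>k. bounded (V k) \<and> diameter (V k) \<le> r"
    using U(2) by (auto simp: V_def split: prod.split)
  moreover have "(\<Sum>k. ennreal (diam_powr s (V k))) \<le> ennreal e"
  proof -
    have "(\<Sum>k. ennreal (diam_powr s (V k))) = (\<Sum>i. \<Sum>j. ennreal (diam_powr s (U i j)))"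
      using suminf_ennreal_2dimen[of "\<lambda>i. \<Sum>j. ennreal (diam_powr s (U i j))"
          "\<lambda>(i, j). ennreal (diam_powr s (U i j))"]
      by (simp add: V_def case_prod_beta')
    also have "\<dots> \<le> (\<Sum>i. ennreal (e * (1 / 2) ^ Suc i))"
      by (intro suminf_le U(3)) auto
    also have "\<dots> = ennreal e"
    proof (rule suminf_ennreal_eq)
      show "(\<lambda>i. e * (1 / 2) ^ Suc i) sums e"
        using sums_mult[OF power_half_series, of e] by simp
    qed (use re in auto)
    finally show ?thesis .
  qed
  ultimately show "\<exists>V :: nat \<Rightarrow> 'a set. (\<Union>i. A i) \<subseteq> (\<Union>k. V k) \<and> (\<forall>k. bounded (V k) \<and> diameter (V k) \<le> r) \<and>
      (\<Sum>k. ennreal (diam_powr s (V k))) \<le> ennreal e" by blast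
qed

section \<open>Porous sets in the cube grid\<close>

text \<open>
  The half-open cubes of side \<open>\<beta>\<^sup>-\<^sup>j\<close> form a partition, so a cube is represented by the integer
  vector of its lower corner multiplied by \<open>\<beta>\<^sup>j\<close>. Functions instead of vectors make
  counting by \<open>card_PiE\<close> available.
\<close>

definition cube_index :: "nat \<Rightarrow> nat \<Rightarrow> real ^ 'n \<Rightarrow> 'n \<Rightarrow> int" where
  "cube_index \<beta> j x = (\<lambda>i. \<lfloor>real \<beta> ^ j * x $ i\<rfloor>)"

definition subcubes :: "nat \<Rightarrow> ('n \<Rightarrow> int) \<Rightarrow> ('n \<Rightarrow> int) set" where
  "subcubes \<beta> c = (\<Pi>\<^sub>E i\<in>UNIV. {int \<beta> * c i ..< int \<beta> * c i + int \<beta>})"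

lemma
  fixes c :: "'n::finite \<Rightarrow> int"
  shows card_subcubes: "card (subcubes \<beta> c) = \<beta> ^ CARD('n)"
    and finite_subcubes: "finite (subcubes \<beta> c)"
  by (auto simp: subcubes_def card_PiE intro!: finite_PiE)

lemma cube_index_Suc:
  assumes "\<beta> > 0"
  shows "cube_index \<beta> (Suc j) x \<in> subcubes \<beta> (cube_index \<beta> j x)"
proof -
  have "int \<beta> * \<lfloor>y\<rfloor> \<le> \<lfloor>real \<beta> * y\<rfloor> \<and> \<lfloor>real \<beta> * y\<rfloor> < int \<beta> * \<lfloor>y\<rfloor> + int \<beta>" for y :: real
  proof
    have "real \<beta> * of_int \<lfloor>y\<rfloor> \<le> real \<beta> * y" by (intro mult_left_mono) auto
    then show "int \<beta> * \<lfloor>y\<rfloor> \<le> \<lfloor>real \<beta> * y\<rfloor>" by (simp add: le_floor_iff)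
    have "real \<beta> * y < real \<beta> * (of_int \<lfloor>y\<rfloor> + 1)" using assms by (intro mult_strict_left_mono) auto
    then show "\<lfloor>real \<beta> * y\<rfloor> < int \<beta> * \<lfloor>y\<rfloor> + int \<beta>" by (simp add: floor_less_iff algebra_simps)
  qed
  then show ?thesis
    unfolding subcubes_def cube_index_def power_Suc mult.assoc by (simp add: PiE_iff)
qed

lemma dist_le_if_cube_index_eq:
  fixes x y :: "real ^ 'n"
  assumes "cube_index \<beta> j x = cube_index \<beta> j y" "\<beta> > 0"
  shows "dist x y \<le> real CARD('n) / real \<beta> ^ j"
proof -
  have "\<bar>(x - y) $ i\<bar> \<le> 1 / real \<beta> ^ j" for i
  proof -
    have "\<lfloor>real \<beta> ^ j * x $ i\<rfloor> = \<lfloor>real \<beta> ^ j * y $ i\<rfloor>"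
      using assms(1) by (simp add: cube_index_def fun_eq_iff)
    then have "\<bar>real \<beta> ^ j * x $ i - real \<beta> ^ j * y $ i\<bar> \<le> 1" by linarith
    then have "real \<beta> ^ j * \<bar>x $ i - y $ i\<bar> \<le> 1"
      by (simp add: abs_mult flip: right_diff_distrib)
    then show ?thesis using assms(2) by (simp add: field_simps)
  qed
  then show ?thesis using norm_le_card_times_bound[of "x - y" "1 / real \<beta> ^ j"] by (simp add: dist_norm)
qed

text \<open>
  Refining the grid splits each cube into \<open>\<beta>\<^sup>n\<close> parts, one of which is empty if \<open>j \<in> G\<close>.
\<close>

lemma card_occupied_cubes_le:
  fixes A :: "(real ^ 'n) set"
  assumes \<beta>: "\<beta> > 0"
    and hole: "\<And>j c. j \<in> G \<Longrightarrow> \<exists>d\<in>subcubes \<beta> c. \<forall>x\<in>A. cube_index \<beta> (Suc j) x \<noteq> d"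
    and A: "\<And>x. x \<in> A \<Longrightarrow> cube_index \<beta> 0 x = c0"
  shows "finite (cube_index \<beta> J ` A) \<and> real (card (cube_index \<beta> J ` A))
    \<le> real (\<beta> ^ CARD('n)) ^ J * (1 - 1 / real (\<beta> ^ CARD('n))) ^ card {j. j < J \<and> j \<in> G}"
proof (induction J)
  case 0
  have sub: "cube_index \<beta> 0 ` A \<subseteq> {c0}" using A by auto
  then show ?case using card_mono[OF _ sub] finite_subset[OF sub] by simp
next
  case (Suc J)
  define m where "m = (if J \<in> G then \<beta> ^ CARD('n) - 1 else \<beta> ^ CARD('n))"
  define ch where "ch c = subcubes \<beta> c \<inter> cube_index \<beta> (Suc J) ` A" for c
  have ch: "finite (ch c)" "card (ch c) \<le> m" for c
  proof -
    show "finite (ch c)" by (simp add: ch_def finite_subcubes)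
    show "card (ch c) \<le> m"
    proof (cases "J \<in> G")
      case True
      then obtain d where d: "d \<in> subcubes \<beta> c" "\<forall>x\<in>A. cube_index \<beta> (Suc J) x \<noteq> d"
        using hole by blast
      then have "ch c \<subseteq> subcubes \<beta> c - {d}" by (auto simp: ch_def)
      then have "card (ch c) \<le> card (subcubes \<beta> c - {d})"
        by (intro card_mono) (auto simp: finite_subcubes)
      then show ?thesis using d(1) True by (simp add: m_def card_subcubes finite_subcubes)
    next
      case False
      then show ?thesis using card_mono[OF finite_subcubes, of "ch c" \<beta> c]
        by (auto simp: m_def ch_def card_subcubes)
    qed
  qed
  have sub: "cube_index \<beta> (Suc J) ` A \<subseteq> (\<Union>c\<in>cube_index \<beta> J ` A. ch c)"
    using cube_index_Suc[OF \<beta>] by (fastforce simp: ch_def)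
  have fin: "finite (\<Union>c\<in>cube_index \<beta> J ` A. ch c)" using Suc ch(1) by blast
  have "card (cube_index \<beta> (Suc J) ` A) \<le> card (\<Union>c\<in>cube_index \<beta> J ` A. ch c)"
    by (rule card_mono[OF fin sub])
  also have "\<dots> \<le> (\<Sum>c\<in>cube_index \<beta> J ` A. card (ch c))" using Suc by (intro card_UN_le) auto
  also have "\<dots> \<le> card (cube_index \<beta> J ` A) * m"
    using sum_bounded_above[of "cube_index \<beta> J ` A" "\<lambda>c. card (ch c)" m] ch(2) by simp
  finally have "real (card (cube_index \<beta> (Suc J) ` A)) \<le> real (card (cube_index \<beta> J ` A)) * real m"
    by (simp flip: of_nat_mult)
  also have "\<dots> \<le> real (\<beta> ^ CARD('n)) ^ J
      * (1 - 1 / real (\<beta> ^ CARD('n))) ^ card {j. j < J \<and> j \<in> G} * real m"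
    using Suc by (intro mult_right_mono) auto
  also have "\<dots> = real (\<beta> ^ CARD('n)) ^ Suc J
      * (1 - 1 / real (\<beta> ^ CARD('n))) ^ card {j. j < Suc J \<and> j \<in> G}"
  proof (cases "J \<in> G")
    case True
    have "{j. j < Suc J \<and> j \<in> G} = insert J {j. j < J \<and> j \<in> G}" using True by (auto simp: less_Suc_eq)
    moreover have "real m = real (\<beta> ^ CARD('n)) * (1 - 1 / real (\<beta> ^ CARD('n)))"
      using True \<beta> by (simp add: m_def of_nat_diff right_diff_distrib Suc_leI)
    ultimately show ?thesis by simp
  next
    case False
    have "{j. j < Suc J \<and> j \<in> G} = {j. j < J \<and> j \<in> G}" using False by (auto simp: less_Suc_eq)
    then show ?thesis using False by (simp add: m_def)
  qed
  finally show ?case using finite_subset[OF sub fin] by blast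
qed

text \<open>
  Inside a unit cube, the cover by the occupied cubes of side \<open>\<beta>\<^sup>-\<^sup>J\<close> has an \<open>s\<close>-dimensional sum of
  at most a constant times \<open>\<rho>\<^sup>J\<close>, where \<open>\<rho> < 1\<close> is the product in the hypothesis \<open>small\<close>, as soon
  as a third of the indices below \<open>J\<close> belong to \<open>G\<close>.
\<close>

lemma hausdorff_measure_0_if_porous:
  fixes A :: "(real ^ 'n) set"
  assumes \<beta>: "\<beta> \<ge> 2" and s: "s > 0"
    and small: "real \<beta> powr (real CARD('n) - s) * (1 - 1 / real (\<beta> ^ CARD('n))) powr (1 / 3) < 1"
    and hole: "\<And>j c. j \<in> G \<Longrightarrow> \<exists>d\<in>subcubes \<beta> c. \<forall>x\<in>A. cube_index \<beta> (Suc j) x \<noteq> d"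
    and often: "\<exists>\<^sub>F J in sequentially. J \<le> 3 * card {j. j < J \<and> j \<in> G}"
  shows "hausdorff_measure s A = 0"
proof -
  define \<theta> where "\<theta> = 1 - 1 / real (\<beta> ^ CARD('n))"
  define \<rho> where "\<rho> = real \<beta> powr (real CARD('n) - s) * \<theta> powr (1 / 3)"
  have "\<beta> ^ 1 \<le> \<beta> ^ CARD('n)" using \<beta> by (intro power_increasing) (auto simp: Suc_leI)
  then have "2 \<le> \<beta> ^ CARD('n)" using \<beta> by simp
  then have two_le: "2 \<le> real (\<beta> ^ CARD('n))" by (metis of_nat_le_iff of_nat_numeral)
  have \<theta>: "0 < \<theta>" "\<theta> < 1" proof -
    have "1 / x \<le> 1 / 2 \<and> 0 < 1 / x" if "2 \<le> x" for x :: real using that by (simp add: field_simps)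
    from this[OF two_le] show "0 < \<theta>" "\<theta> < 1" unfolding \<theta>_def by linarith+
  qed
  have \<rho>: "0 < \<rho>" "\<rho> < 1" 
    using \<beta> \<theta> small by (simp add: \<rho>_def, simp add: \<rho>_def \<theta>_def)
  have null: "hausdorff_measure s (A \<inter> {x. cube_index \<beta> 0 x = c0}) = 0" for c0
    unfolding hausdorff_measure_eq_0_iff
  proof (intro allI impI)
    fix r e :: real assume re: "r > 0" "e > 0"
    let ?A = "A \<inter> {x. cube_index \<beta> 0 x = c0}"
    let ?n = "real CARD('n)"
    have "(\<lambda>J. ?n * (1 / real \<beta>) ^ J) \<longlonglongrightarrow> ?n * 0"
      using \<beta> by (intro tendsto_mult tendsto_const LIMSEQ_power_zero) auto
    then have "\<forall>\<^sub>F J in sequentially. ?n * (1 / real \<beta>) ^ J < r"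
      using re by (intro order_tendstoD) auto
    moreover have "(\<lambda>J. ?n powr s * \<rho> ^ J) \<longlonglongrightarrow> ?n powr s * 0"
      using \<rho> by (intro tendsto_mult tendsto_const LIMSEQ_power_zero) auto
    then have "\<forall>\<^sub>F J in sequentially. ?n powr s * \<rho> ^ J < e"
      using re by (intro order_tendstoD) auto
    ultimately have "\<forall>\<^sub>F J in sequentially. ?n * (1 / real \<beta>) ^ J < r \<and> ?n powr s * \<rho> ^ J < e"
      by eventually_elim auto
    from frequently_eventually_frequently[OF often this]
    obtain J where J: "J \<le> 3 * card {j. j < J \<and> j \<in> G}" "?n * (1 / real \<beta>) ^ J < r" "?n powr s * \<rho> ^ J < e"
      using frequently_ex by blast
    define F where "F = cube_index \<beta> J ` ?A"
    have hole': "\<exists>d\<in>subcubes \<beta> c. \<forall>x\<in>?A. cube_index \<beta> (Suc j) x \<noteq> d" if "j \<in> G" for j c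
      using hole[OF that, of c] by blast
    have "finite F \<and> real (card F) \<le> real (\<beta> ^ CARD('n)) ^ J * \<theta> ^ card {j. j < J \<and> j \<in> G}"
      unfolding F_def \<theta>_def
    proof (rule card_occupied_cubes_le)
      show "\<beta> > 0" using \<beta> by simp
      show "cube_index \<beta> 0 x = c0" if "x \<in> ?A" for x using that by simp
    qed (rule hole')
    then have finF: "finite F"
      and cardF: "real (card F) \<le> real (\<beta> ^ CARD('n)) ^ J * \<theta> ^ card {j. j < J \<and> j \<in> G}"
      by blast+
    (* The finite cover is extended by empty sets, which contribute nothing to the sum. *)
    obtain N and h :: "nat \<Rightarrow> 'n \<Rightarrow> int" where h: "F = h ` {i. i < N}" "inj_on h {i. i < N}"
      using finite_imp_nat_seg_image_inj_on[OF finF] by blast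
    have N: "N = card F" using h by (simp add: card_image)
    define U where "U i = (if i < N then {x \<in> ?A. cube_index \<beta> J x = h i} else {})" for i
    have close: "dist x y \<le> ?n * (1 / real \<beta>) ^ J" if "x \<in> U i" "y \<in> U i" for x y i
      using that dist_le_if_cube_index_eq[of \<beta> J x y] \<beta>
      by (auto simp: U_def power_one_over field_simps split: if_splits)
    have diam: "diameter (U i) \<le> ?n * (1 / real \<beta>) ^ J" for i
      using close[of _ i] \<beta> by (intro diameter_le) (auto simp: dist_norm)
    have bdd: "bounded (U i)" for i
      unfolding bounded_two_points using close by blast
    have "?A \<subseteq> (\<Union>i. U i)"
    proof
      fix x assume x: "x \<in> ?A"
      then have "cube_index \<beta> J x \<in> h ` {i. i < N}" using h(1) by (auto simp: F_def)
      then obtain i where "i < N" "cube_index \<beta> J x = h i" by auto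
      then have "x \<in> U i" using x by (simp add: U_def)
      then show "x \<in> (\<Union>i. U i)" by blast
    qed
    moreover have "\<forall>i. bounded (U i) \<and> diameter (U i) \<le> r"
      using bdd diam J(2) by (meson less_imp_le order_trans)
    moreover have "(\<Sum>i. ennreal (diam_powr s (U i))) \<le> ennreal e"
    proof -
      have dp: "diam_powr s (U i) \<le> (?n * (1 / real \<beta>) ^ J) powr s" for i
        using s diam[of i] diameter_ge_0[OF bdd[of i]] unfolding diam_powr_def
        by (auto intro!: powr_mono2)
      have "(\<Sum>i. ennreal (diam_powr s (U i))) = (\<Sum>i<N. ennreal (diam_powr s (U i)))"
        by (rule suminf_finite) (auto simp: U_def diam_powr_def)
      also have "\<dots> \<le> (\<Sum>i<N. ennreal ((?n * (1 / real \<beta>) ^ J) powr s))"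
        by (intro sum_mono ennreal_leI dp)
      also have "\<dots> = ennreal (real N * (?n * (1 / real \<beta>) ^ J) powr s)"
        by (subst sum_ennreal) auto
      also have "real N * (?n * (1 / real \<beta>) ^ J) powr s \<le> ?n powr s * \<rho> ^ J"
      proof -
        have "\<theta> ^ card {j. j < J \<and> j \<in> G} = \<theta> powr (card {j. j < J \<and> j \<in> G})"
          using \<theta> by (simp add: powr_realpow)
        also have "\<dots> \<le> \<theta> powr (real J / 3)"
          using \<theta> J(1) by (intro powr_mono') auto
        finally have "real N \<le> real (\<beta> ^ CARD('n)) ^ J * \<theta> powr (real J / 3)"
          using cardF unfolding N by (elim order_trans) (auto intro!: mult_left_mono)
        then have "real N * (?n * (1 / real \<beta>) ^ J) powr s
            \<le> real (\<beta> ^ CARD('n)) ^ J * \<theta> powr (real J / 3) * (?n * (1 / real \<beta>) ^ J) powr s"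
          by (rule mult_right_mono) auto
        also have "real (\<beta> ^ CARD('n)) ^ J = real \<beta> powr (?n * real J)"
          using \<beta> by (simp add: powr_realpow flip: powr_powr)
        also have diam_eq: "(?n * (1 / real \<beta>) ^ J) powr s = ?n powr s * real \<beta> powr (- (real J * s))"
          using \<beta> by (simp add: powr_mult powr_divide powr_minus_divide power_one_over powr_powr flip: powr_realpow)
        also have "real \<beta> powr (?n * real J) * \<theta> powr (real J / 3) * (?n powr s * real \<beta> powr (- (real J * s)))
            = ?n powr s * (real \<beta> powr ((?n - s) * real J) * \<theta> powr (real J / 3))"
          by (simp add: algebra_simps powr_diff powr_minus_divide)
        also have "real \<beta> powr ((?n - s) * real J) * \<theta> powr (real J / 3) = \<rho> ^ J"
          using \<beta> \<theta> \<rho> unfolding powr_realpow[OF \<rho>(1), symmetric] by (simp add: \<rho>_def powr_mult powr_powr)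
        finally show ?thesis unfolding diam_eq .
      qed
      also have "ennreal (?n powr s * \<rho> ^ J) \<le> ennreal e" using J(3) by (intro ennreal_leI) simp
      finally show ?thesis by (simp add: ennreal_leI)
    qed
    ultimately show "\<exists>U :: nat \<Rightarrow> (real ^ 'n) set. ?A \<subseteq> (\<Union>i. U i) \<and> (\<forall>i. bounded (U i) \<and> diameter (U i) \<le> r) \<and>
      (\<Sum>i. ennreal (diam_powr s (U i))) \<le> ennreal e" by blast
  qed
  have "\<exists>i. cube_index \<beta> 0 x = from_nat i" for x :: "real ^ 'n"
    by (metis from_nat_to_nat)
  then have "A = (\<Union>i. A \<inter> {x. cube_index \<beta> 0 x = from_nat i})" by blast
  with hausdorff_measure_0_countable_Union[OF null] show ?thesis by metis
qed

section \<open>Badly approximable targets\<close>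

text \<open>
  The centre \<open>w\<close> of the cube \<open>c\<close> is approximated by an orbit point \<open>l v\<close> to within
  \<open>\<beta>\<^sup>-\<^sup>j / 64\<close>, so that a translate \<open>y\<close> of \<open>l v\<close> by an integer vector lies in the cube. Every point
  \<open>x\<close> in the subcube of \<open>y\<close> has distance at most \<open>n \<beta>\<^sup>-\<^sup>j\<^sup>-\<^sup>1\<close> from \<open>y\<close>, and \<open>l \<le> (2 D + 1) N\<close>. This
  makes \<open>l\<^sup>1\<^sup>/\<^sup>n \<langle>l v - x\<rangle>\<close> at most \<open>n (2 D + 1) D / \<beta> \<le> \<epsilon>\<close>.
\<close>

lemma hole_in_cube_if_not_resonant:
  fixes v :: "real ^ 'n" and j :: nat
  assumes \<beta>: "\<beta> > 0"
    and L: "L = (64 * CARD('n)) ^ CARD('n) + 1" and D: "D = 3 * L"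
    and \<epsilon>: "real CARD('n) * real ((2 * D + 1) * D) \<le> \<epsilon> * real \<beta>"
    and N: "N = (D * \<beta> ^ j) ^ CARD('n)"
    and v: "v \<notin> resonant N (1 / (64 * real (D * \<beta> ^ j)))"
    and K: "K \<le> N"
  shows "\<exists>d\<in>subcubes \<beta> c. \<forall>x.
    (\<forall>k\<ge>K. \<epsilon> < real k powr (1 / real CARD('n)) * dist_int (real k *\<^sub>R v - x)) \<longrightarrow> cube_index \<beta> (Suc j) x \<noteq> d"
proof -
  define n where "n = CARD('n)"
  define B where "B = \<beta> ^ j"
  define r where "r = 1 / (64 * real (D * B))"
  define w :: "real ^ 'n" where "w = (\<chi> i. (of_int (c i) + 1 / 2) / real B)"
  have n: "n > 0" by (simp add: n_def)
  have B: "B > 0" using \<beta> by (simp add: B_def)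
  have L0: "L > 0" and D0: "D > 0" using L D by auto
  have N0: "N > 0" using D0 \<beta> by (simp add: N)
  have r: "r > 0" using D0 B by (simp add: r_def)
  have Dr: "real D * r = 1 / (64 * real B)" using D0 B by (simp add: r_def)
  have sep: "r \<le> dist_int (real q *\<^sub>R v)" if "q \<in> {1..N}" for q
    using v that by (force simp: resonant_def r_def B_def)
  have m: "64 * n * (D * B) > 0" "real CARD('n) / real (64 * n * (D * B)) \<le> r"
    using n D0 B by (auto simp: r_def n_def)
  have LN: "(64 * n * (D * B)) ^ CARD('n) < L * N"
    using N0 by (simp add: L N n_def B_def power_mult_distrib)
  (* The covering lemma yields an index k of either sign with |k| at most D * N. Applied to a point
     shifted back by (D + 1) * N steps of the orbit, it yields an index of size at least N. *)
  obtain k :: int where k: "\<bar>k\<bar> \<le> 3 * int L * int N"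
      "dist_int (w - real ((D + 1) * N) *\<^sub>R v - of_int k *\<^sub>R v) \<le> 3 * real L * r"
    using orbit_dense_if_separated[OF r sep m LN, of "w - real ((D + 1) * N) *\<^sub>R v"] by blast
  define l where "l = nat (int ((D + 1) * N) + k)"
  have kD: "\<bar>k\<bar> \<le> int D * int N" using k(1) by (simp add: D)
  then have l: "int l = int ((D + 1) * N) + k" by (simp add: l_def algebra_simps)
  have l_ge: "N \<le> l"
  proof -
    have "int N \<le> int l" using kD unfolding l by (simp add: algebra_simps)
    then show ?thesis by simp
  qed
  have l_le: "l \<le> (2 * D + 1) * N"
  proof -
    have "int l \<le> int ((2 * D + 1) * N)" using kD unfolding l by (simp add: algebra_simps)
    then show ?thesis by (simp only: of_nat_le_iff)
  qed
  have lv: "w - real ((D + 1) * N) *\<^sub>R v - of_int k *\<^sub>R v = w - real l *\<^sub>R v"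
  proof -
    have "real l = real ((D + 1) * N) + of_int k"
      using arg_cong[OF l, of real_of_int] by simp
    then show ?thesis by (simp only: scaleR_add_left diff_diff_add)
  qed
  have "dist_int (w - real l *\<^sub>R v) \<le> 1 / (64 * real B)"
    using k(2) Dr unfolding lv by (simp add: D)
  also have "\<dots> < 1 / (4 * real B)" using B by (simp add: field_simps)
  finally obtain z where z: "z \<in> int_lattice" "dist (w - real l *\<^sub>R v) z < 1 / (4 * real B)"
    using dist_int_less_obtain by blast
  define y where "y = real l *\<^sub>R v + z"
  have "cube_index \<beta> j y = c"
  proof
    fix i
    have "\<bar>w $ i - y $ i\<bar> \<le> norm (w - y)"
      using component_le_norm_cart[of "w - y" i] by simp
    also have "\<dots> < 1 / (4 * real B)" using z(2) by (simp add: y_def dist_norm diff_diff_add)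
    finally have "real B * \<bar>w $ i - y $ i\<bar> < 1 / 4" using B by (simp add: field_simps)
    then have "\<bar>real B * w $ i - real B * y $ i\<bar> < 1 / 4"
      by (simp add: abs_mult flip: right_diff_distrib)
    moreover have "real B * w $ i = of_int (c i) + 1 / 2" using B by (simp add: w_def)
    ultimately have "\<lfloor>real B * y $ i\<rfloor> = c i" by linarith
    then show "cube_index \<beta> j y i = c i" by (simp add: cube_index_def B_def)
  qed
  then have "cube_index \<beta> (Suc j) y \<in> subcubes \<beta> c" using cube_index_Suc[OF \<beta>, of j y] by simp
  moreover have "cube_index \<beta> (Suc j) x \<noteq> cube_index \<beta> (Suc j) y"
    if x: "\<forall>k\<ge>K. \<epsilon> < real k powr (1 / real CARD('n)) * dist_int (real k *\<^sub>R v - x)" for x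
  proof
    assume "cube_index \<beta> (Suc j) x = cube_index \<beta> (Suc j) y"
    then have "dist x y \<le> real n / real \<beta> ^ Suc j"
      unfolding n_def using \<beta> by (rule dist_le_if_cube_index_eq)
    moreover have "dist_int (real l *\<^sub>R v - x) \<le> dist (real l *\<^sub>R v - x) (- z)"
      using z(1) by (intro dist_int_le_dist int_lattice_uminus)
    then have "dist_int (real l *\<^sub>R v - x) \<le> dist x y"
      by (simp add: dist_norm y_def norm_minus_commute algebra_simps)
    ultimately have d: "dist_int (real l *\<^sub>R v - x) \<le> real n / real \<beta> ^ Suc j" by linarith
    have "l \<le> ((2 * D + 1) * (D * B)) ^ n"
    proof -
      have "(2 * D + 1) ^ 1 \<le> (2 * D + 1) ^ n" using n by (intro power_increasing) auto
      then have "(2 * D + 1) * N \<le> (2 * D + 1) ^ n * (D * B) ^ n"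
        unfolding N n_def B_def by (intro mult_right_mono) auto
      with l_le show ?thesis by (simp only: power_mult_distrib order_trans)
    qed
    then have "real l \<le> real ((2 * D + 1) * (D * B)) ^ n" by (metis of_nat_le_iff of_nat_power)
    then have "real l powr (1 / real n) \<le> (real ((2 * D + 1) * (D * B)) ^ n) powr (1 / real n)"
      by (intro powr_mono2) auto
    also have "\<dots> = real ((2 * D + 1) * (D * B))"
    proof -
      have "(X ^ n) powr (1 / real n) = X" if "X > 0" for X :: real
        using that n by (simp add: powr_powr flip: powr_realpow)
      moreover have "real ((2 * D + 1) * (D * B)) > 0"
        using D0 B by (simp only: of_nat_0_less_iff) simp
      ultimately show ?thesis .
    qed
    finally have "real l powr (1 / real n) * dist_int (real l *\<^sub>R v - x)
        \<le> real ((2 * D + 1) * (D * B)) * (real n / real \<beta> ^ Suc j)"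
      using d by (intro mult_mono) (auto simp: dist_int_def infdist_nonneg)
    also have "\<dots> = real n * real ((2 * D + 1) * D) / real \<beta>"
      using \<beta> by (simp add: B_def field_simps)
    also have "\<dots> \<le> \<epsilon>" using \<epsilon> \<beta> by (simp add: n_def field_simps)
    finally have "real l powr (1 / real n) * dist_int (real l *\<^sub>R v - x) \<le> \<epsilon>" .
    moreover have "K \<le> l" using K l_ge by (rule order_trans)
    ultimately show False using x unfolding n_def by (meson not_less)
  qed
  ultimately show ?thesis by blast
qed

text \<open>
  Discarding the finitely many indices below \<open>K\<close> lowers the proportion from a half to a third.
\<close>

lemma frequently_many_good:
  assumes freq: "\<exists>\<^sub>F J in sequentially. 2 * card {j. j < J \<and> P j} \<le> J"
    and fin: "\<And>j. K \<le> j \<Longrightarrow> Q j"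
  shows "\<exists>\<^sub>F J in sequentially. J \<le> 3 * card {j. j < J \<and> \<not> P j \<and> Q j}"
proof -
  have "\<forall>\<^sub>F J in sequentially. 6 * K \<le> J" by (rule eventually_ge_at_top)
  from frequently_eventually_frequently[OF freq this] show ?thesis
  proof (rule frequently_elim1)
    fix J assume J: "2 * card {j. j < J \<and> P j} \<le> J \<and> 6 * K \<le> J"
    have "{..<J} \<subseteq> {j. j < J \<and> P j} \<union> {j. j < J \<and> \<not> P j \<and> Q j} \<union> {..<K}"
      using fin by (auto simp: not_less)
    then have "card {..<J} \<le> card ({j. j < J \<and> P j} \<union> {j. j < J \<and> \<not> P j \<and> Q j} \<union> {..<K})"
      by (intro card_mono) auto
    also have "\<dots> \<le> card {j. j < J \<and> P j} + card {j. j < J \<and> \<not> P j \<and> Q j} + card {..<K}"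
      by (intro order_trans[OF card_Un_le] add_right_mono card_Un_le)
    finally show "J \<le> 3 * card {j. j < J \<and> \<not> P j \<and> Q j}" using J by simp
  qed
qed

theorem theorem1p5:
  fixes \<epsilon> :: real
  assumes "\<epsilon> > 0"
  shows "\<exists>\<delta>>0. AE v :: real ^ 'n in lebesgue.
           hausdorff_dim (Bad \<epsilon> v) < ereal (real CARD('n) - \<delta>)"
proof -
  define n where "n = CARD('n)"
  have n: "n \<ge> 1" by (simp add: n_def Suc_leI)
  (* The torus holds at most (64 * n)^n * N points that are separated as the multiples of a
     nonresonant vector are, so L exceeds the possible number of shells. *)
  define L where "L = (64 * n) ^ n + 1"
  define D where "D = 3 * L"
  have D: "D \<ge> 1" by (simp add: D_def L_def)
  obtain \<beta>0 :: nat where \<beta>0: "real n * real ((2 * D + 1) * D) / (\<epsilon> / 2) < real \<beta>0"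
    using reals_Archimedean2 by blast
  define \<beta> where "\<beta> = \<beta>0 + 2"
  have \<beta>: "\<beta> \<ge> 2" by (simp add: \<beta>_def)
  have \<beta>\<epsilon>: "real n * real ((2 * D + 1) * D) \<le> \<epsilon> / 2 * real \<beta>"
  proof -
    have "real n * real ((2 * D + 1) * D) / (\<epsilon> / 2) < real \<beta>" using \<beta>0 by (simp add: \<beta>_def)
    then show ?thesis using assms by (simp only: pos_divide_less_eq half_gt_zero_iff mult.commute less_imp_le)
  qed
  (* theta is the average gain per scale when a third of the scales have a hole; an exponent
     n - t with t small enough is still beaten by it. *)
  define \<theta> where "\<theta> = (1 - 1 / real (\<beta> ^ n)) powr (1 / 3)"
  have "1 < \<beta> ^ n" using \<beta> n by (intro one_less_power) auto
  then have "1 < real (\<beta> ^ n)" by (metis of_nat_less_iff of_nat_1)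
  moreover have "0 \<le> 1 - 1 / x \<and> 1 - 1 / x < 1" if "1 < x" for x :: real
    using that by (simp add: field_simps)
  ultimately have "0 \<le> 1 - 1 / real (\<beta> ^ n) \<and> 1 - 1 / real (\<beta> ^ n) < 1" by blast
  then have "\<theta> < 1"
    using powr_less_mono2[of "1 / 3" "1 - 1 / real (\<beta> ^ n)" 1]
    unfolding \<theta>_def by (simp del: of_nat_power)
  have "((\<lambda>t. real \<beta> powr t * \<theta>) \<longlongrightarrow> real \<beta> powr 0 * \<theta>) (at_right 0)"
    using \<beta> by (intro tendsto_intros) auto
  then have "\<forall>\<^sub>F t in at_right 0. real \<beta> powr t * \<theta> < 1"
    using \<open>\<theta> < 1\<close> \<beta> by (intro order_tendstoD(2)) auto
  moreover have "\<forall>\<^sub>F t in at_right (0 :: real). t < 1"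
    by (rule order_tendstoD(2)[OF tendsto_ident_at]) simp
  moreover have "\<forall>\<^sub>F t in at_right (0 :: real). t > 0" by (simp add: eventually_at_right_less)
  ultimately have "\<forall>\<^sub>F t in at_right 0. real \<beta> powr t * \<theta> < 1 \<and> t < 1 \<and> t > 0"
    by eventually_elim auto
  then obtain t where t: "real \<beta> powr t * \<theta> < 1" "t < 1" "t > 0"
    using eventually_happens'[OF trivial_limit_at_right_real] by blast
  define s where "s = real n - t"
  have s: "s > 0" "real n - s = t" using t n by (auto simp: s_def)
  define N where "N j = (D * \<beta> ^ j) ^ CARD('n)" for j
  define R :: "nat \<Rightarrow> (real ^ 'n) set" where "R j = resonant (N j) (1 / (64 * real (D * \<beta> ^ j)))" for j
  have N_ge: "j \<le> N j" for j
  proof -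
    have "j \<le> \<beta> ^ j" using \<beta> self_le_power less_exp
      by (meson less_imp_le order_trans power_mono zero_le)
    also have "\<dots> \<le> D * \<beta> ^ j" using D by simp
    also have "\<dots> \<le> (D * \<beta> ^ j) ^ CARD('n)" using D \<beta> by (intro self_le_power) auto
    finally show ?thesis by (simp add: N_def)
  qed
  have "AE v in lebesgue. \<exists>\<^sub>F J in sequentially. 2 * card {j. j < J \<and> v \<in> R j} \<le> J"
    unfolding R_def N_def
    by (intro AE_frequently_few_hits sets_resonant eventually_measure_resonant_le D \<beta>)
  then have "AE v :: real ^ 'n in lebesgue. hausdorff_dim (Bad \<epsilon> v) < ereal (real CARD('n) - t / 2)"
  proof eventually_elim
    fix v :: "real ^ 'n"
    assume v: "\<exists>\<^sub>F J in sequentially. 2 * card {j. j < J \<and> v \<in> R j} \<le> J"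
    (* The hole at a scale needs the inequality at all indices of that size, so Bad is split
       according to the index from which it holds. *)
    define A where "A K = {w. \<forall>k\<ge>K. \<epsilon> / 2 < real k powr (1 / real CARD('n)) * dist_int (real k *\<^sub>R v - w)}" for K
    have "hausdorff_measure s (A K) = 0" for K
    proof (rule hausdorff_measure_0_if_porous[OF \<beta> s(1), where G = "{j. v \<notin> R j \<and> K \<le> N j}"])
      show "real \<beta> powr (real CARD('n) - s) * (1 - 1 / real (\<beta> ^ CARD('n))) powr (1 / 3) < 1"
        using t(1) s(2) by (simp add: n_def \<theta>_def)
      show "\<exists>d\<in>subcubes \<beta> c. \<forall>x\<in>A K. cube_index \<beta> (Suc j) x \<noteq> d"
        if j: "j \<in> {j. v \<notin> R j \<and> K \<le> N j}" for j c
        using hole_in_cube_if_not_resonant[of \<beta> L D "\<epsilon> / 2" "N j" j v K c] j \<beta> \<beta>\<epsilon>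
        by (auto simp: n_def L_def D_def N_def R_def A_def)
      show "\<exists>\<^sub>F J in sequentially. J \<le> 3 * card {j. j < J \<and> j \<in> {j. v \<notin> R j \<and> K \<le> N j}}"
        using frequently_many_good[OF v, of K "\<lambda>j. K \<le> N j"] N_ge by (auto intro: order_trans)
    qed
    then have "hausdorff_measure s (\<Union>K. A K) = 0" by (rule hausdorff_measure_0_countable_Union)
    moreover have "Bad \<epsilon> v \<subseteq> (\<Union>K. A K)"
    proof
      fix w assume "w \<in> Bad \<epsilon> v"
      then have "ereal (\<epsilon> / 2) < liminf (\<lambda>k. ereal (real k powr (1 / real CARD('n)) * dist_int (real k *\<^sub>R v - w)))"
        using assms unfolding Bad_def by (auto intro: less_le_trans[rotated])
      from less_LiminfD[OF this] show "w \<in> (\<Union>K. A K)"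
        by (auto simp: eventually_sequentially A_def)
    qed
    ultimately have "hausdorff_measure s (Bad \<epsilon> v) = 0" by (rule hausdorff_measure_0_mono)
    then have "hausdorff_dim (Bad \<epsilon> v) \<le> ereal s"
      unfolding hausdorff_dim_def using s(1) by (intro INF_lower) auto
    also have "ereal s < ereal (real CARD('n) - t / 2)" using t by (simp add: s_def n_def)
    finally show "hausdorff_dim (Bad \<epsilon> v) < ereal (real CARD('n) - t / 2)" .
  qed
  then show ?thesis using t(3) by (intro exI[of _ "t / 2"]) auto
qed

end
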